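(* Let $m,p,L,N,T,T_{\mathrm{ini}},T_{\mathrm{f}}\in\mathbb{Z}_{\ge 0}$ and let $\mathcal{B}^*\in\mathsf{LTI}^{m,p}$ satisfy $\ell(\mathcal{B}^* )\le L$ and $n(\mathcal{B}^* )\le N$. Let $(u^{\mathrm d},y^{\mathrm d})\in\mathcal{B}^*_{[0,T-1]}$, $(u^{\mathrm{ini}},y^{\mathrm{ini}})\in\mathcal{B}^*_{[0,T_{\mathrm{ini}}-1]}$, and $u^{\mathrm f}\in\mathbb{R}^{mT_{\mathrm f}}$. If $T_{\mathrm{ini}}\ge L_{\max}$ and the procedure $\textsc{PredictAndWeave}(u^{\mathrm d},y^{\mathrm d},u^{\mathrm{ini}},y^{\mathrm{ini}},u^{\mathrm f},L_{\max})$ returns a vector $y^{\mathrm f}$ (i.e. does not return null), then $(u^{\mathrm d},y^{\mathrm d})$ is informative for unique prediction of $u^{\mathrm f}$ from $(u^{\mathrm{ini}},y^{\mathrm{ini}})$ and $y^{\mathrm f}$ is the unique prediction.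
   Context: **Behaviors.** Consider linear time-invariant systems $x(t+1)=Ax(t)+Bu(t)$, $y(t)=Cx(t)+Du(t)$, $t\in\mathbb{Z}_{\ge0}$, with real matrices $A\in\mathbb{R}^{n\times n}$, $B\in\mathbb{R}^{n\times m}$, $C\in\mathbb{R}^{p\times n}$, $D\in\mathbb{R}^{p\times m}$ ($n\in\mathbb{Z}_{\ge0}$; $n=0$ means a static system $y=Du$). The behavior of the system is $\mathcal{B}=\{(u,y)\in(\mathbb{R}^m)^{\mathbb{Z}_{\ge0}}\times(\mathbb{R}^p)^{\mathbb{Z}_{\ge0}} \mid \exists x\in(\mathbb{R}^n)^{\mathbb{Z}_{\ge0}}$ such that the system equations hold for all $t\in\mathbb{Z}_{\ge0}\}$; the system is called a state-space representation of $\mathcal{B}$. $\mathsf{LTI}^{m,p}$ is the set of all such behaviors with $m$ inputs and $p$ outputs (any $n$). $n(\mathcal{B})$ is the smallest state dimension among all state-space representations of $\mathcal{B}$; a representation attaining it is minimal. With $\mathcal{O}_0$ the $0\times n$ void matrix (rank $0$) and $\mathcal{O}_k=\begin{pmatrix} C \\ C A \\ \vdots \\ C A^{k-1} \end{pmatrix}$ for $k>0$, the lag is $\ell(\mathcal{B})=\min\{k\in\mathbb{Z}_{\ge0}\mid \operatorname{rank}\mathcal{O}_k=\operatorname{rank}\mathcal{O}_{k+1}\}$, computed from a minimal representation of $\mathcal{B}$. **Restrictions.** $w_{[t_0,t_1]}=(w(t_0),\dots,w(t_1))$ is a stacked column vector, and $\mathcal{B}_{[t_0,t_1]}=\{(u_{[t_0,t_1]},y_{[t_0,t_1]})\mid(u,y)\in\mathcal{B}\}$.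 The notation $(u^{\mathrm{ini}},u^{\mathrm f},y^{\mathrm{ini}},y^{\mathrm f})\in\mathcal{B}_{[0,T_{\mathrm{ini}}+T_{\mathrm f}-1]}$ means that the pair consisting of the concatenated input $(u^{\mathrm{ini}},u^{\mathrm f})$ and concatenated output $(y^{\mathrm{ini}},y^{\mathrm f})$ belongs to the restricted behavior. **Explaining systems.** $\mathcal{M}=\{\mathcal{B}\in\mathsf{LTI}^{m,p}\mid \ell(\mathcal{B})\le L,\ n(\mathcal{B})\le N\}$. For a length-$T'$ pair $(\bar u,\bar y)$, $\Sigma(\bar u,\bar y)=\{\mathcal{B}\in\mathcal{M}\mid(\bar u,\bar y)\in\mathcal{B}_{[0,T'-1]}\}$. Put $\Sigma_{\mathrm d}=\Sigma(u^{\mathrm d},y^{\mathrm d})$, $\Sigma_{\mathrm{ini}}=\Sigma(u^{\mathrm{ini}},y^{\mathrm{ini}})$, and $L_{\max}=\max\{\ell(\mathcal{B})\mid\mathcal{B}\in\Sigma_{\mathrm d}\cap\Sigma_{\mathrm{ini}}\}$. **Informativity.** $(u^{\mathrm d},y^{\mathrm d})$ is informative for unique prediction of $u^{\mathrm f}$ from $(u^{\mathrm{ini}},y^{\mathrm{ini}})$ if (i) for every $\mathcal{B}\in\Sigma_{\mathrm d}\cap\Sigma_{\mathrm{ini}}$ there exists a unique $y^{\mathrm f}\in\mathbb{R}^{pT_{\mathrm f}}$ with $(u^{\mathrm{ini}},u^{\mathrm f},y^{\mathrm{ini}},y^{\mathrm f})\in\mathcal{B}_{[0,T_{\mathrm{ini}}+T_{\mathrm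 f}-1]}$; and (ii) there exists $y^{\mathrm f}\in\mathbb{R}^{pT_{\mathrm f}}$ with $(u^{\mathrm{ini}},u^{\mathrm f},y^{\mathrm{ini}},y^{\mathrm f})\in\mathcal{B}_{[0,T_{\mathrm{ini}}+T_{\mathrm f}-1]}$ for all $\mathcal{B}\in\Sigma_{\mathrm d}\cap\Sigma_{\mathrm{ini}}$. In that case the (necessarily unique) $y^{\mathrm f}$ in (ii) is called the unique prediction. **Hankel matrices.** For $w=(w(0),\dots,w(T'-1))$ with $w(t)\in\mathbb{R}^q$, $\mathcal{H}_k(w)$ is the $qk\times0$ void matrix if $T'<k$, and for $T'\ge k$ is the $qk\times(T'-k+1)$ matrix whose $j$-th column ($j=0,\dots,T'-k$) is $(w(j),w(j+1),\dots,w(j+k-1))$. The image of a void matrix with zero columns is $\{0\}$. **Procedure $\textsc{Predict}(u^{\mathrm d},y^{\mathrm d},u^{\mathrm{ini}},y^{\mathrm{ini}},u^{\mathrm f},\ell)$**, where $(u^{\mathrm{ini}},y^{\mathrm{ini}})$ has length $T_{\mathrm{ini}}\ge\ell$ and $u^{\mathrm f}$ has length $T_{\mathrm f}$ (both lengths are inferred from the arguments of the call). Partition $$\begin{pmatrix} U_{\mathrm p} \\ U_{\mathrm f} \\ Y_{\mathrm p} \\ Y_{\mathrm f} \end{pmatrix}=\begin{pmatrix} \mathcal{H}_{\ell+T_{\mathrm f}}(u^{\mathrm d}) & \mathcal{H}_{\ell+T_{\mathrm f}}(u^{\mathrm{ini}}) \\ \mathcal{H}_{\ell+T_{\mathrm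 f}}(y^{\mathrm d}) & \mathcal{H}_{\ell+T_{\mathrm f}}(y^{\mathrm{ini}}) \end{pmatrix}$$ with $U_{\mathrm p},U_{\mathrm f},Y_{\mathrm p},Y_{\mathrm f}$ having $m\ell,\ mT_{\mathrm f},\ p\ell,\ pT_{\mathrm f}$ rows respectively. Let $\bar u^{\mathrm{ini}}=u^{\mathrm{ini}}_{[T_{\mathrm{ini}}-\ell,T_{\mathrm{ini}}-1]}$, $\bar y^{\mathrm{ini}}=y^{\mathrm{ini}}_{[T_{\mathrm{ini}}-\ell,T_{\mathrm{ini}}-1]}$. If there is a vector $g$ with $U_{\mathrm p}g=\bar u^{\mathrm{ini}}$, $U_{\mathrm f}g=u^{\mathrm f}$, $Y_{\mathrm p}g=\bar y^{\mathrm{ini}}$, return $Y_{\mathrm f}g$ for such a $g$ (any choice); otherwise return null. **Procedure $\textsc{PredictAndWeave}(u^{\mathrm d},y^{\mathrm d},u^{\mathrm{ini}},y^{\mathrm{ini}},u^{\mathrm f},\ell)$.** Set $\bar u^0=u^{\mathrm{ini}}$, $\bar y^0=y^{\mathrm{ini}}$. For $t=0,1,\dots,T_{\mathrm f}-1$: let $y^{\mathrm f}(t)$ be the output of $\textsc{Predict}(u^{\mathrm d},y^{\mathrm d},\bar u^t,\bar y^t,u^{\mathrm f}(t),\ell)$ (a one-step prediction, with initial trajectory $(\bar u^t,\bar y^t)$ of length $T_{\mathrm{ini}}+t$ and future input of length $1$); if it is null, return null and stop; otherwise set $\bar u^{t+1}=(\bar u^t,u^{\mathrm f}(t))$, $\bar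 y^{t+1}=(\bar y^t,y^{\mathrm f}(t))$. After the loop return $y^{\mathrm f}=(y^{\mathrm f}(0),\dots,y^{\mathrm f}(T_{\mathrm f}-1))$. *)

theory Defs
  imports "Jordan_Normal_Form.DL_Rank"
begin

(* Dimensions range over all natural numbers (0 included) and state dimensions are quantified,
   hence the carrier-based matrices.  A finite trajectory w(0), ..., w(T-1) is the list of its
   samples, so that its length is determined even if the samples have dimension 0;
   stacked vectors are produced by stack. *)

type_synonym signal = "nat \<Rightarrow> real vec"
type_synonym traj = "real vec list"
type_synonym behavior = "(signal \<times> signal) set"

definition ss_behavior ::
  "nat \<Rightarrow> nat \<Rightarrow> nat \<Rightarrow> real mat \<Rightarrow> real mat \<Rightarrow> real mat \<Rightarrow> real mat \<Rightarrow> behavior" where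
  "ss_behavior m p n A B C D =
     {(u, y). (\<forall>t. u t \<in> carrier_vec m) \<and> (\<forall>t. y t \<in> carrier_vec p) \<and>
        (\<exists>x. (\<forall>t. x t \<in> carrier_vec n) \<and>
             (\<forall>t. x (t + 1) = A *\<^sub>v x t + B *\<^sub>v u t \<and> y t = C *\<^sub>v x t + D *\<^sub>v u t))}"

definition is_representation ::
  "nat \<Rightarrow> nat \<Rightarrow> behavior \<Rightarrow> nat \<Rightarrow> real mat \<Rightarrow> real mat \<Rightarrow> real mat \<Rightarrow> real mat \<Rightarrow> bool" where
  "is_representation m p \<B> n A B C D \<longleftrightarrow>
     A \<in> carrier_mat n n \<and> B \<in> carrier_mat n m \<and> C \<in> carrier_mat p n \<and> D \<in> carrier_mat p m \<and>
     \<B> = ss_behavior m p n A B C D"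

definition LTI :: "nat \<Rightarrow> nat \<Rightarrow> behavior set" where
  "LTI m p = {\<B>. \<exists>n A B C D. is_representation m p \<B> n A B C D}"

definition state_dim :: "nat \<Rightarrow> nat \<Rightarrow> behavior \<Rightarrow> nat" where
  "state_dim m p \<B> = (LEAST n. \<exists>A B C D. is_representation m p \<B> n A B C D)"

fun obs_mat :: "real mat \<Rightarrow> real mat \<Rightarrow> nat \<Rightarrow> real mat" where
  "obs_mat C A 0 = 0\<^sub>m 0 (dim_col A)"
| "obs_mat C A (Suc k) = obs_mat C A k @\<^sub>r (C * (A ^\<^sub>m k))"

(* The first argument of vec_space.rank is the number of rows. *)
definition obs_lag :: "nat \<Rightarrow> real mat \<Rightarrow> real mat \<Rightarrow> nat" where
  "obs_lag p C A =
     (LEAST k. vec_space.rank (p * k) (obs_mat C A k)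
             = vec_space.rank (p * (k + 1)) (obs_mat C A (k + 1)))"

(* The value does not depend on the minimal representation that is selected: the image of
   obs_mat C A k consists of the stacked outputs y(0), ..., y(k-1) of the trajectories in the
   behavior with zero input. *)
definition lag :: "nat \<Rightarrow> nat \<Rightarrow> behavior \<Rightarrow> nat" where
  "lag m p \<B> =
     (SOME l. \<exists>A B C D. is_representation m p \<B> (state_dim m p \<B>) A B C D \<and> l = obs_lag p C A)"

definition trajs :: "nat \<Rightarrow> nat \<Rightarrow> traj set" where
  "trajs q T = {w. length w = T \<and> set w \<subseteq> carrier_vec q}"

(* The restriction to the time interval [0, T-1], which is empty for T = 0. *)
definition restrict_beh :: "behavior \<Rightarrow> nat \<Rightarrow> (traj \<times> traj) set" where
  "restrict_beh \<B> T = {(map u [0..<T], map y [0..<T]) | u y. (u, y) \<in> \<B>}"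

definition model_class :: "nat \<Rightarrow> nat \<Rightarrow> nat \<Rightarrow> nat \<Rightarrow> behavior set" where
  "model_class m p L N = {\<B> \<in> LTI m p. lag m p \<B> \<le> L \<and> state_dim m p \<B> \<le> N}"

definition explaining ::
  "nat \<Rightarrow> nat \<Rightarrow> nat \<Rightarrow> nat \<Rightarrow> traj \<Rightarrow> traj \<Rightarrow> behavior set" where
  "explaining m p L N u y = {\<B> \<in> model_class m p L N. (u, y) \<in> restrict_beh \<B> (length u)}"

definition L_max ::
  "nat \<Rightarrow> nat \<Rightarrow> nat \<Rightarrow> nat \<Rightarrow> traj \<Rightarrow> traj \<Rightarrow> traj \<Rightarrow> traj \<Rightarrow> nat" where
  "L_max m p L N ud yd uini yini =
     Max (lag m p ` (explaining m p L N ud yd \<inter> explaining m p L N uini yini))"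

definition common_prediction ::
  "nat \<Rightarrow> nat \<Rightarrow> nat \<Rightarrow> nat \<Rightarrow> traj \<Rightarrow> traj \<Rightarrow> traj \<Rightarrow> traj \<Rightarrow> traj \<Rightarrow> traj \<Rightarrow> bool" where
  "common_prediction m p L N ud yd uini yini uf yf \<longleftrightarrow>
     yf \<in> trajs p (length uf) \<and>
     (\<forall>\<B> \<in> explaining m p L N ud yd \<inter> explaining m p L N uini yini.
        (uini @ uf, yini @ yf) \<in> restrict_beh \<B> (length uini + length uf))"

definition informative ::
  "nat \<Rightarrow> nat \<Rightarrow> nat \<Rightarrow> nat \<Rightarrow> traj \<Rightarrow> traj \<Rightarrow> traj \<Rightarrow> traj \<Rightarrow> traj \<Rightarrow> bool" where
  "informative m p L N ud yd uini yini uf \<longleftrightarrow>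
     (\<forall>\<B> \<in> explaining m p L N ud yd \<inter> explaining m p L N uini yini.
        \<exists>!yf. yf \<in> trajs p (length uf) \<and>
              (uini @ uf, yini @ yf) \<in> restrict_beh \<B> (length uini + length uf)) \<and>
     (\<exists>yf. common_prediction m p L N ud yd uini yini uf yf)"

definition is_unique_prediction ::
  "nat \<Rightarrow> nat \<Rightarrow> nat \<Rightarrow> nat \<Rightarrow> traj \<Rightarrow> traj \<Rightarrow> traj \<Rightarrow> traj \<Rightarrow> traj \<Rightarrow> traj \<Rightarrow> bool" where
  "is_unique_prediction m p L N ud yd uini yini uf yf \<longleftrightarrow>
     informative m p L N ud yd uini yini uf \<and>
     (\<forall>yf'. common_prediction m p L N ud yd uini yini uf yf' \<longleftrightarrow> yf' = yf)"

definition stack :: "traj \<Rightarrow> real vec" where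
  "stack w = foldr (@\<^sub>v) w (0\<^sub>v 0)"

(* By truncated subtraction there are no columns if length w < k. *)
definition hankel :: "nat \<Rightarrow> nat \<Rightarrow> traj \<Rightarrow> real mat" where
  "hankel q k w =
     mat_of_cols (q * k) (map (\<lambda>j. stack (take k (drop j w))) [0..<length w + 1 - k])"

definition row_block :: "nat \<Rightarrow> nat \<Rightarrow> real mat \<Rightarrow> real mat" where
  "row_block i r M = mat r (dim_col M) (\<lambda>(a, b). M $$ (i + a, b))"

(* The set of possible results of the prediction procedure, one for each choice of g;
   None stands for null, and a proper result is a stacked vector. *)
definition predict ::
  "nat \<Rightarrow> nat \<Rightarrow> traj \<Rightarrow> traj \<Rightarrow> traj \<Rightarrow> traj \<Rightarrow> traj \<Rightarrow> nat \<Rightarrow> real vec option set" where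
  "predict m p ud yd uini yini uf l =
    (let Tini = length uini; Tf = length uf;
         M = four_block_mat
               (hankel m (l + Tf) ud) (hankel m (l + Tf) uini)
               (hankel p (l + Tf) yd) (hankel p (l + Tf) yini);
         Up = row_block 0 (m * l) M;
         Uf = row_block (m * l) (m * Tf) M;
         Yp = row_block (m * l + m * Tf) (p * l) M;
         Yf = row_block (m * l + m * Tf + p * l) (p * Tf) M;
         G = {g \<in> carrier_vec (dim_col M).
                Up *\<^sub>v g = stack (drop (Tini - l) uini) \<and>
                Uf *\<^sub>v g = stack uf \<and>
                Yp *\<^sub>v g = stack (drop (Tini - l) yini)}
     in if G = {} then {None} else {Some (Yf *\<^sub>v g) | g. g \<in> G})"

(* The set of possible results over all choices made in the one-step predictions; the recursion
   consumes the future input, while the initial trajectory grows. *)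
fun predict_and_weave ::
  "nat \<Rightarrow> nat \<Rightarrow> traj \<Rightarrow> traj \<Rightarrow> traj \<Rightarrow> traj \<Rightarrow> traj \<Rightarrow> nat \<Rightarrow> traj option set" where
  "predict_and_weave m p ud yd ubar ybar [] l = {Some []}"
| "predict_and_weave m p ud yd ubar ybar (v # uf) l =
     (\<Union>r \<in> predict m p ud yd ubar ybar [v] l.
        case r of
          None \<Rightarrow> {None}
        | Some y \<Rightarrow>
            map_option ((#) y) ` predict_and_weave m p ud yd (ubar @ [v]) (ybar @ [y]) uf l)"

end

theory Submission
  imports Defs "Jordan_Normal_Form.Matrix_Kernel"
begin

text \<open>
  Let \<open>\<B>\<close> explain both the data and the initial trajectory; then its lag is at most \<open>l = L_max\<close>.
  The Hankel columns are trajectories of \<open>\<B>\<close> on \<open>[0, l]\<close>, hence so is every linear combination of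
  them. Two trajectories of \<open>\<B>\<close> with the same inputs on \<open>[0, l]\<close> and the same outputs on \<open>[0, l - 1]\<close>
  have the same output at \<open>l\<close>: the difference of their initial states is in the kernel of the
  observability matrix \<open>O_l\<close>, and by rank-nullity the kernels of \<open>O_k\<close> are constant for \<open>k\<close> from the
  lag on. So each one-step prediction is the next output of every explaining \<open>\<B>\<close>, and the extended
  trajectory is again a valid initial trajectory for all of them.
\<close>

section \<open>Rank, nullity and inclusion of matrix kernels\<close>

lemma rank_nullity_mat:
  fixes A :: "'a::field mat"
  assumes A: "A \<in> carrier_mat nr nc"
  shows "vec_space.rank nr A + kernel_dim A = nc"
proof -
  interpret K: kernel nr nc A by unfold_locales (rule A)
  interpret W: vec_space "TYPE('a)" nr .
  have hom: "(\<lambda>v. A *\<^sub>v v) \<in> LinearCombinations.module_hom class_ring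
      (module_vec TYPE('a) nc) (module_vec TYPE('a) nr)"
    unfolding LinearCombinations.module_hom_def using A
    by (auto simp: module_vec_simps mult_add_distrib_mat_vec[OF A] mult_mat_vec[OF A])
  have mh: "mod_hom class_ring K.NC.V W.V (\<lambda>v. A *\<^sub>v v)"
    by (rule mod_hom.intro[OF vec_module vec_module mod_hom_axioms.intro[OF hom]])
  have lm: "linear_map class_ring K.NC.V W.V (\<lambda>v. A *\<^sub>v v)"
    by (rule linear_map.intro[OF vec_vs vec_vs mh])
  have ker: "mod_hom.ker K.NC.V W.V (\<lambda>v. A *\<^sub>v v) = mat_kernel A"
    using A by (auto simp: mod_hom.ker_def[OF mh] mat_kernel_def)
  \<comment> \<open>The span of the columns has dimension \<open>W.rank A\<close> by definition,
    which turns abstract rank-nullity for a linear map into a statement about matrices.\<close>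
  have im: "mod_hom.im K.NC.V (\<lambda>v. A *\<^sub>v v) = W.span (set (cols A))"
  proof -
    have "W.span (set (cols A)) = {y \<in> carrier_vec nr. \<exists>x\<in>carrier_vec nc. A *\<^sub>v x = y}"
      using W.col_space_eq[OF A] unfolding W.col_space_def carrier_matD[OF A] .
    also have "\<dots> = (\<lambda>v. A *\<^sub>v v) ` carrier_vec nc"
      using mult_mat_vec_carrier[OF A] by blast
    finally show ?thesis unfolding mod_hom.im_def[OF mh] module_vec_simps by (rule sym)
  qed
  have "W.rank A + K.dim = K.NC.dim"
    using linear_map.rank_nullity[OF lm K.NC.fin_dim] unfolding ker im W.rank_def .
  then show ?thesis by (simp add: K.NC.dim_is_n)
qed

text \<open>A basis of the smaller kernel stays independent in the larger one, which bounds the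
  dimensions; when these agree it is a basis of both, and both kernels are its span.\<close>

lemma mat_kernel_mono_dim:
  fixes A B :: "'a::field mat"
  assumes A: "A \<in> carrier_mat nr nc" and B: "B \<in> carrier_mat nr' nc"
    and sub: "mat_kernel A \<subseteq> mat_kernel B"
  shows "kernel_dim A \<le> kernel_dim B"
    and "kernel_dim A = kernel_dim B \<Longrightarrow> mat_kernel A = mat_kernel B"
proof -
  interpret KA: kernel nr nc A by unfold_locales (rule A)
  interpret KB: kernel nr' nc B by unfold_locales (rule B)
  obtain S where S: "finite S" "KA.basis S" using kernel_basis_exists[OF A] by blast
  obtain R where R: "finite R" "KB.basis R" using kernel_basis_exists[OF B] by blast
  have fd: "KB.Ker.fin_dim" using R unfolding KB.Ker.fin_dim_def KB.Ker.basis_def by auto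
  have SA: "S \<subseteq> mat_kernel A" and li: "\<not> KA.lin_dep S" and gen: "KA.gen_set S"
    using S(2) unfolding KA.Ker.basis_def by auto
  have SB: "S \<subseteq> mat_kernel B" using SA sub by auto
  have liB: "\<not> KB.lin_dep S"
    using li KA.lindep_same[OF SA] KB.lindep_same[OF SB] by simp
  have dimA: "KA.dim = card S" using KA.Ker.dim_basis[OF S] .
  show "kernel_dim A \<le> kernel_dim B"
    using KB.Ker.li_le_dim(2)[OF fd SB liB] dimA by simp
  assume eq: "kernel_dim A = kernel_dim B"
  have "KB.basis S"
    using KB.Ker.dim_li_is_basis[OF fd S(1) SB liB] eq dimA by simp
  then have "KB.gen_set S" unfolding KB.Ker.basis_def by auto
  then show "mat_kernel A = mat_kernel B"
    using gen KA.span_same[OF SA] KB.span_same[OF SB] by auto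
qed

text \<open>The lag compares ranks of matrices with different numbers of rows; the number of columns
  is shared, so by rank-nullity equal ranks mean equal kernel dimensions.\<close>

lemma rank_eq_imp_mat_kernel_eq:
  fixes A B :: "'a::field mat"
  assumes A: "A \<in> carrier_mat nr nc" and B: "B \<in> carrier_mat nr' nc"
    and sub: "mat_kernel A \<subseteq> mat_kernel B"
    and rank: "vec_space.rank nr A = vec_space.rank nr' B"
  shows "mat_kernel A = mat_kernel B"
  using mat_kernel_mono_dim(2)[OF A B sub] rank_nullity_mat[OF A] rank_nullity_mat[OF B] rank
  by simp

section \<open>Observability matrices and the lag of a pair \<open>(C, A)\<close>\<close>

lemma pow_mat_Suc_mult_vec:
  assumes "A \<in> carrier_mat n n" "z \<in> carrier_vec n"
  shows "A ^\<^sub>m (Suc k) *\<^sub>v z = A ^\<^sub>m k *\<^sub>v (A *\<^sub>v z)"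
  using assms by (simp add: assoc_mult_mat_vec[of _ n n _ n])

lemma pow_mat_add_mult_vec:
  assumes A: "A \<in> carrier_mat n n" and z: "z \<in> carrier_vec n"
  shows "A ^\<^sub>m (i + j) *\<^sub>v z = A ^\<^sub>m i *\<^sub>v (A ^\<^sub>m j *\<^sub>v z)"
  using z
\<comment> \<open>The new factor of \<open>A ^\<^sub>m Suc j\<close> acts on \<open>z\<close> first,
  so the induction hypothesis is needed at \<open>A *\<^sub>v z\<close>.\<close>
proof (induction j arbitrary: z)
  case (Suc j)
  have "A ^\<^sub>m (i + Suc j) *\<^sub>v z = A ^\<^sub>m (i + j) *\<^sub>v (A *\<^sub>v z)"
    using pow_mat_Suc_mult_vec[OF A Suc.prems, of "i + j"] by simp
  also have "\<dots> = A ^\<^sub>m i *\<^sub>v (A ^\<^sub>m j *\<^sub>v (A *\<^sub>v z))"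
    using A Suc by (intro Suc.IH) auto
  finally show ?case using pow_mat_Suc_mult_vec[OF A Suc.prems] by simp
qed (use A in auto)

lemma obs_mat_carrier:
  assumes "A \<in> carrier_mat n n" "C \<in> carrier_mat p n"
  shows "obs_mat C A k \<in> carrier_mat (p * k) n"
proof (induction k)
  case (Suc k)
  have "C * A ^\<^sub>m k \<in> carrier_mat p n" using assms by auto
  from carrier_append_rows[OF Suc this] show ?case by (simp add: add.commute)
qed (use assms in auto)

text \<open>Reads the kernel as a set of initial states:
  \<open>C *\<^sub>v (A ^\<^sub>m i *\<^sub>v z)\<close> is the output at time \<open>i\<close> of
  the system started in \<open>z\<close> with zero input.\<close>

lemma obs_mat_kernel_iff:
  assumes A: "A \<in> carrier_mat n n" and C: "C \<in> carrier_mat p n" and z: "z \<in> carrier_vec n"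
  shows "z \<in> mat_kernel (obs_mat C A k) \<longleftrightarrow> (\<forall>i<k. C *\<^sub>v (A ^\<^sub>m i *\<^sub>v z) = 0\<^sub>v p)"
proof (induction k)
  case 0
  have "0\<^sub>m 0 n *\<^sub>v z = 0\<^sub>v 0" by auto
  then show ?case using A z by (simp add: mat_kernel[of _ 0 n])
next
  case (Suc k)
  let ?O = "obs_mat C A k" and ?R = "C * A ^\<^sub>m k"
  have O: "?O \<in> carrier_mat (p * k) n" by (rule obs_mat_carrier[OF A C])
  have R: "?R \<in> carrier_mat p n" using A C by auto
  have Rz: "?R *\<^sub>v z = C *\<^sub>v (A ^\<^sub>m k *\<^sub>v z)"
    using A C z by (simp add: assoc_mult_mat_vec[of _ p n _ n])
  have "0\<^sub>v (p * Suc k) = 0\<^sub>v (p * k) @\<^sub>v (0\<^sub>v p :: real vec)" by (auto simp: append_vec_def Let_def)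
  then have "obs_mat C A (Suc k) *\<^sub>v z = 0\<^sub>v (p * Suc k)
      \<longleftrightarrow> (?O *\<^sub>v z) @\<^sub>v (?R *\<^sub>v z) = 0\<^sub>v (p * k) @\<^sub>v 0\<^sub>v p"
    using mat_mult_append[OF O R z] by simp
  also have "\<dots> \<longleftrightarrow> ?O *\<^sub>v z = 0\<^sub>v (p * k) \<and> ?R *\<^sub>v z = 0\<^sub>v p"
    using O z by (intro append_vec_eq[of _ "p * k"]) auto
  finally show ?case
    using Suc z unfolding mat_kernel[OF O] mat_kernel[OF obs_mat_carrier[OF A C]]
    by (auto simp: Rz less_Suc_eq)
qed

lemma obs_mat_kernel_antimono:
  assumes A: "A \<in> carrier_mat n n" and C: "C \<in> carrier_mat p n"
  shows "mat_kernel (obs_mat C A (Suc k)) \<subseteq> mat_kernel (obs_mat C A k)"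
proof
  fix z assume z: "z \<in> mat_kernel (obs_mat C A (Suc k))"
  then have "z \<in> carrier_vec n" using mat_kernel_carrier[OF obs_mat_carrier[OF A C]] by blast
  from z show "z \<in> mat_kernel (obs_mat C A k)"
    unfolding obs_mat_kernel_iff[OF A C \<open>z \<in> carrier_vec n\<close>] by simp
qed

text \<open>\<open>LEAST\<close> has its property only if some \<open>k\<close> has it: the ranks
  are nondecreasing, as the kernels shrink, and never exceed \<open>n\<close>, so they cannot grow
  at every step.\<close>

lemma obs_lag_rank:
  assumes A: "A \<in> carrier_mat n n" and C: "C \<in> carrier_mat p n"
  shows "vec_space.rank (p * obs_lag p C A) (obs_mat C A (obs_lag p C A))
       = vec_space.rank (p * (obs_lag p C A + 1)) (obs_mat C A (obs_lag p C A + 1))"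
proof -
  define r where "r k = vec_space.rank (p * k) (obs_mat C A k)" for k
  have mono: "r k \<le> r (Suc k)" for k
  proof -
    note c = obs_mat_carrier[OF A C]
    from mat_kernel_mono_dim(1)[OF c c obs_mat_kernel_antimono[OF A C, of k]] show ?thesis
      using rank_nullity_mat[OF c, of k] rank_nullity_mat[OF c, of "Suc k"]
      unfolding r_def by linarith
  qed
  have bound: "r k \<le> n" for k
    unfolding r_def using rank_nullity_mat[OF obs_mat_carrier[OF A C, of k]] by linarith
  have "\<exists>k. r k = r (k + 1)"
  proof (rule ccontr)
    assume "\<nexists>k. r k = r (k + 1)"
    then have less: "r k < r (Suc k)" for k using mono[of k] by (simp add: le_neq_implies_less)
    have "k \<le> r k" for k 
    proof (induction k)
      case (Suc k)
      then show ?case using less[of k] by linarith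
    qed simp
    with bound[of "Suc n"] show False by (meson Suc_n_not_le_n le_trans)
  qed
  then show ?thesis unfolding r_def obs_lag_def by (rule LeastI_ex)
qed

text \<open>With \<open>?k = obs_lag p C A\<close>, the kernel does not shrink from
  \<open>?k\<close> to \<open>?k + 1\<close>. The state reached from \<open>z\<close> after
  \<open>l - ?k\<close> steps has \<open>?k\<close> zero outputs, hence also the next one, which is
  the output of \<open>z\<close> at time \<open>l\<close>.\<close>

lemma obs_lag_unobservable:
  assumes A: "A \<in> carrier_mat n n" and C: "C \<in> carrier_mat p n" and z: "z \<in> carrier_vec n"
    and l: "obs_lag p C A \<le> l" and zero: "\<And>i. i < l \<Longrightarrow> C *\<^sub>v (A ^\<^sub>m i *\<^sub>v z) = 0\<^sub>v p"
  shows "C *\<^sub>v (A ^\<^sub>m l *\<^sub>v z) = 0\<^sub>v p"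
proof -
  let ?k = "obs_lag p C A" let ?z = "A ^\<^sub>m (l - ?k) *\<^sub>v z"
  note c = obs_mat_carrier[OF A C]
  have z': "?z \<in> carrier_vec n"
    by (rule mult_mat_vec_carrier[OF pow_carrier_mat[OF A] z])
  have pow: "A ^\<^sub>m i *\<^sub>v ?z = A ^\<^sub>m (i + (l - ?k)) *\<^sub>v z" for i
    by (rule pow_mat_add_mult_vec[OF A z, symmetric])
  have "mat_kernel (obs_mat C A (Suc ?k)) = mat_kernel (obs_mat C A ?k)"
    using rank_eq_imp_mat_kernel_eq[OF c c obs_mat_kernel_antimono[OF A C]] obs_lag_rank[OF A C]
    by simp
  moreover have "?z \<in> mat_kernel (obs_mat C A ?k)"
    unfolding obs_mat_kernel_iff[OF A C z'] pow using zero l by simp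
  ultimately have "?z \<in> mat_kernel (obs_mat C A (Suc ?k))" by (simp only:)
  then have "C *\<^sub>v (A ^\<^sub>m (?k + (l - ?k)) *\<^sub>v z) = 0\<^sub>v p"
    unfolding obs_mat_kernel_iff[OF A C z'] pow by blast
  then show ?thesis using l by simp
qed

section \<open>Closure properties of LTI behaviors\<close>

lemma ss_behaviorI:
  assumes "\<And>t. u t \<in> carrier_vec m" "\<And>t. y t \<in> carrier_vec p" "\<And>t. x t \<in> carrier_vec n"
    and "\<And>t. x (Suc t) = A *\<^sub>v x t + B *\<^sub>v u t" "\<And>t. y t = C *\<^sub>v x t + D *\<^sub>v u t"
  shows "(u, y) \<in> ss_behavior m p n A B C D"
  using assms unfolding ss_behavior_def by (auto intro!: exI[of _ x])

lemma ss_behaviorE: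
  assumes "(u, y) \<in> ss_behavior m p n A B C D"
  obtains x where "\<And>t. u t \<in> carrier_vec m" "\<And>t. y t \<in> carrier_vec p" "\<And>t. x t \<in> carrier_vec n"
    "\<And>t. x (Suc t) = A *\<^sub>v x t + B *\<^sub>v u t" "\<And>t. y t = C *\<^sub>v x t + D *\<^sub>v u t"
proof -
  from assms obtain x where "\<forall>t. u t \<in> carrier_vec m" "\<forall>t. y t \<in> carrier_vec p"
    "\<forall>t. x t \<in> carrier_vec n"
    "\<forall>t. x (t + 1) = A *\<^sub>v x t + B *\<^sub>v u t \<and> y t = C *\<^sub>v x t + D *\<^sub>v u t"
    unfolding ss_behavior_def by blast
  then show thesis by (intro that[of x]) simp_all
qed

lemma LTI_carrier:
  assumes "\<B> \<in> LTI m p" "(u, y) \<in> \<B>"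
  shows "u t \<in> carrier_vec m" "y t \<in> carrier_vec p"
  using assms unfolding LTI_def is_representation_def ss_behavior_def by auto

lemma LTI_shift:
  assumes "\<B> \<in> LTI m p" "(u, y) \<in> \<B>"
  shows "(\<lambda>t. u (t + s), \<lambda>t. y (t + s)) \<in> \<B>"
proof -
  from assms(1) obtain n A B C D where \<B>: "\<B> = ss_behavior m p n A B C D"
    unfolding LTI_def is_representation_def by blast
  from assms(2) obtain x where
    "\<And>t. u t \<in> carrier_vec m" "\<And>t. y t \<in> carrier_vec p" "\<And>t. x t \<in> carrier_vec n"
    "\<And>t. x (Suc t) = A *\<^sub>v x t + B *\<^sub>v u t" "\<And>t. y t = C *\<^sub>v x t + D *\<^sub>v u t"
    unfolding \<B> by (rule ss_behaviorE) (rule that)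
  then show ?thesis unfolding \<B> by (intro ss_behaviorI[where x = "\<lambda>t. x (t + s)"]) auto
qed

lemma LTI_zero:
  assumes "\<B> \<in> LTI m p"
  shows "(\<lambda>t. 0\<^sub>v m, \<lambda>t. 0\<^sub>v p) \<in> \<B>"
proof -
  from assms obtain n A B C D where R: "A \<in> carrier_mat n n" "B \<in> carrier_mat n m"
      "C \<in> carrier_mat p n" "D \<in> carrier_mat p m" and \<B>: "\<B> = ss_behavior m p n A B C D"
    unfolding LTI_def is_representation_def by blast
  show ?thesis unfolding \<B> using R by (intro ss_behaviorI[where x = "\<lambda>t. 0\<^sub>v n"]) auto
qed

lemma mult_mat_vec_add_smult:
  fixes A :: "real mat"
  assumes A: "A \<in> carrier_mat nr nc" and v: "v \<in> carrier_vec nc" and w: "w \<in> carrier_vec nc"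
  shows "A *\<^sub>v (v + a \<cdot>\<^sub>v w) = A *\<^sub>v v + a \<cdot>\<^sub>v (A *\<^sub>v w)"
  using assms by (simp add: mult_add_distrib_mat_vec[OF A v] mult_mat_vec[OF A w])

lemma add_smult_regroup:
  fixes v :: "real vec"
  assumes "v \<in> carrier_vec n" "v' \<in> carrier_vec n" "w \<in> carrier_vec n" "w' \<in> carrier_vec n"
  shows "(v + v') + a \<cdot>\<^sub>v (w + w') = (v + a \<cdot>\<^sub>v w) + (v' + a \<cdot>\<^sub>v w')"
  using assms by (intro eq_vecI) (auto simp: algebra_simps)

lemma LTI_add_smult:
  assumes "\<B> \<in> LTI m p" "(u, y) \<in> \<B>" "(u', y') \<in> \<B>"
  shows "(\<lambda>t. u t + a \<cdot>\<^sub>v u' t, \<lambda>t. y t + a \<cdot>\<^sub>v y' t) \<in> \<B>"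
proof -
  from assms(1) obtain n A B C D where R: "A \<in> carrier_mat n n" "B \<in> carrier_mat n m"
      "C \<in> carrier_mat p n" "D \<in> carrier_mat p m" and \<B>: "\<B> = ss_behavior m p n A B C D"
    unfolding LTI_def is_representation_def by blast
  from assms(2) obtain x where x:
    "\<And>t. u t \<in> carrier_vec m" "\<And>t. y t \<in> carrier_vec p" "\<And>t. x t \<in> carrier_vec n"
    "\<And>t. x (Suc t) = A *\<^sub>v x t + B *\<^sub>v u t" "\<And>t. y t = C *\<^sub>v x t + D *\<^sub>v u t"
    unfolding \<B> by (rule ss_behaviorE) (rule that)
  from assms(3) obtain x' where x':
    "\<And>t. u' t \<in> carrier_vec m" "\<And>t. y' t \<in> carrier_vec p" "\<And>t. x' t \<in> carrier_vec n"
    "\<And>t. x' (Suc t) = A *\<^sub>v x' t + B *\<^sub>v u' t" "\<And>t. y' t = C *\<^sub>v x' t + D *\<^sub>v u' t"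
    unfolding \<B> by (rule ss_behaviorE) (rule that)
  show ?thesis unfolding \<B>
  proof (rule ss_behaviorI[where x = "\<lambda>t. x t + a \<cdot>\<^sub>v x' t"])
    fix t
    show "u t + a \<cdot>\<^sub>v u' t \<in> carrier_vec m" using x(1)[of t] x'(1)[of t] by simp
    show "y t + a \<cdot>\<^sub>v y' t \<in> carrier_vec p" using x(2)[of t] x'(2)[of t] by simp
    show "x t + a \<cdot>\<^sub>v x' t \<in> carrier_vec n" using x(3)[of t] x'(3)[of t] by simp
    show "x (Suc t) + a \<cdot>\<^sub>v x' (Suc t) = A *\<^sub>v (x t + a \<cdot>\<^sub>v x' t) + B *\<^sub>v (u t + a \<cdot>\<^sub>v u' t)"
      unfolding x(4) x'(4) mult_mat_vec_add_smult[OF R(1) x(3) x'(3)]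
        mult_mat_vec_add_smult[OF R(2) x(1) x'(1)]
      by (rule add_smult_regroup[of _ n])
        (auto intro!: mult_mat_vec_carrier[OF R(1)] mult_mat_vec_carrier[OF R(2)] x(1,3) x'(1,3))
    show "y t + a \<cdot>\<^sub>v y' t = C *\<^sub>v (x t + a \<cdot>\<^sub>v x' t) + D *\<^sub>v (u t + a \<cdot>\<^sub>v u' t)"
      unfolding x(5) x'(5) mult_mat_vec_add_smult[OF R(3) x(3) x'(3)]
        mult_mat_vec_add_smult[OF R(4) x(1) x'(1)]
      by (rule add_smult_regroup[of _ p])
        (auto intro!: mult_mat_vec_carrier[OF R(3)] mult_mat_vec_carrier[OF R(4)] x(1,3) x'(1,3))
  qed
qed

text \<open>The sums are written entrywise, with the coefficient on the right, to match a Hankel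
  matrix times a vector.\<close>

lemma LTI_linear_combination:
  fixes U Y :: "nat \<Rightarrow> signal" and k :: nat
  assumes \<B>: "\<B> \<in> LTI m p" and cols: "\<And>j. j < k \<Longrightarrow> (U j, Y j) \<in> \<B>"
  shows "(\<lambda>t. vec m (\<lambda>i. \<Sum>j<k. U j t $ i * a j), \<lambda>t. vec p (\<lambda>i. \<Sum>j<k. Y j t $ i * a j)) \<in> \<B>"
  using cols
proof (induction k)
  case 0
  have zero: "vec n (\<lambda>i. 0) = (0\<^sub>v n :: real vec)" for n by auto
  show ?case using LTI_zero[OF \<B>] by (simp add: zero)
next
  case (Suc k)
  let ?S = "\<lambda>q W k t. vec q (\<lambda>i. \<Sum>j<k. W j t $ i * a j) :: real vec"
  have new: "(U k, Y k) \<in> \<B>" using Suc.prems by simp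
  have step: "?S q W (Suc k) = (\<lambda>t. ?S q W k t + a k \<cdot>\<^sub>v W k t)"
    if "\<And>t. W k t \<in> carrier_vec q" for q and W :: "nat \<Rightarrow> signal"
    using carrier_vecD[OF that] by (intro ext eq_vecI) (auto simp: mult.commute)
  show ?case
    unfolding step[of U m, OF LTI_carrier(1)[OF \<B> new]] step[of Y p, OF LTI_carrier(2)[OF \<B> new]]
    using LTI_add_smult[OF \<B> _ new] Suc by simp
qed

text \<open>Inputs are free and outputs causal: the state recursion is rerun from the same
  \<open>x 0\<close> with the new input.\<close>

lemma LTI_replace_future_input:
  assumes \<B>: "\<B> \<in> LTI m p" and uy: "(u, y) \<in> \<B>"
    and u': "\<And>t. u' t \<in> carrier_vec m" and past: "\<And>t. t < T \<Longrightarrow> u' t = u t"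
  obtains y' where "(u', y') \<in> \<B>" "\<And>t. t < T \<Longrightarrow> y' t = y t"
proof -
  from \<B> obtain n A B C D where R: "A \<in> carrier_mat n n" "B \<in> carrier_mat n m"
      "C \<in> carrier_mat p n" "D \<in> carrier_mat p m" and \<B>: "\<B> = ss_behavior m p n A B C D"
    unfolding LTI_def is_representation_def by blast
  from uy obtain x where x:
    "\<And>t. u t \<in> carrier_vec m" "\<And>t. y t \<in> carrier_vec p" "\<And>t. x t \<in> carrier_vec n"
    "\<And>t. x (Suc t) = A *\<^sub>v x t + B *\<^sub>v u t" "\<And>t. y t = C *\<^sub>v x t + D *\<^sub>v u t"
    unfolding \<B> by (rule ss_behaviorE) (rule that)
  define x' where "x' = rec_nat (x 0) (\<lambda>t z. A *\<^sub>v z + B *\<^sub>v u' t)"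
  define y' where "y' t = C *\<^sub>v x' t + D *\<^sub>v u' t" for t
  have x'_0: "x' 0 = x 0" and x'_Suc: "x' (Suc t) = A *\<^sub>v x' t + B *\<^sub>v u' t" for t
    by (simp_all add: x'_def)
  have x'_carrier: "x' t \<in> carrier_vec n" for t
    by (induction t) (auto simp: x'_0 x'_Suc x(3) intro!: add_carrier_vec
        mult_mat_vec_carrier[OF R(1)] mult_mat_vec_carrier[OF R(2)] u')
  \<comment> \<open>The state at \<open>T\<close> itself still agrees, since it depends only on
    \<open>x 0\<close> and the inputs before \<open>T\<close>.\<close>
  have x'_past: "t \<le> T \<Longrightarrow> x' t = x t" for t
    by (induction t) (auto simp: x'_0 x'_Suc x(4) past)
  show ?thesis
  proof
    show "(u', y') \<in> \<B>"
      unfolding \<B>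
    proof (rule ss_behaviorI[where x = x'])
      show "y' t \<in> carrier_vec p" for t
        unfolding y'_def by (intro add_carrier_vec mult_mat_vec_carrier[OF R(3)]
            mult_mat_vec_carrier[OF R(4)] u' x'_carrier)
    qed (use u' x'_carrier x'_Suc y'_def in auto)
    show "t < T \<Longrightarrow> y' t = y t" for t using x'_past by (simp add: y'_def x(5) past)
  qed
qed

section \<open>The lag determines the next output\<close>

text \<open>Resolves the choice in \<open>lag\<close>: some representation exists, hence one of
  least dimension, so \<open>SOME\<close> selects the lag of an actual pair
  \<open>(C, A)\<close>.\<close>

lemma lag_representation:
  assumes "\<B> \<in> LTI m p"
  obtains n A B C D where "is_representation m p \<B> n A B C D" "lag m p \<B> = obs_lag p C A"
proof -
  have "\<exists>n A B C D. is_representation m p \<B> n A B C D" using assms unfolding LTI_def by blast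
  then have "\<exists>A B C D. is_representation m p \<B> (state_dim m p \<B>) A B C D"
    unfolding state_dim_def by (rule LeastI_ex)
  then have "\<exists>l A B C D. is_representation m p \<B> (state_dim m p \<B>) A B C D \<and> l = obs_lag p C A"
    by blast
  then have "\<exists>A B C D. is_representation m p \<B> (state_dim m p \<B>) A B C D \<and>
      lag m p \<B> = obs_lag p C A"
    unfolding lag_def by (rule someI_ex)
  then show thesis using that by blast
qed

text \<open>Since the inputs agree, the outputs differ by the zero-input response to the difference
  \<open>z\<close> of the initial states; \<open>obs_lag_unobservable\<close> carries its vanishing
  from the times before \<open>l\<close> to \<open>l\<close>.\<close>

lemma LTI_next_output_unique:
  assumes \<B>: "\<B> \<in> LTI m p" and l: "lag m p \<B> \<le> l"
    and uy: "(u, y) \<in> \<B>" and uy': "(u', y') \<in> \<B>"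
    and u: "\<And>t. t \<le> l \<Longrightarrow> u t = u' t" and y: "\<And>t. t < l \<Longrightarrow> y t = y' t"
  shows "y l = y' l"
proof -
  obtain n A B C D where rep: "is_representation m p \<B> n A B C D" and lag: "lag m p \<B> = obs_lag p C A"
    using \<B> by (rule lag_representation)
  have A: "A \<in> carrier_mat n n" and B: "B \<in> carrier_mat n m"
    and C: "C \<in> carrier_mat p n" and D: "D \<in> carrier_mat p m"
    and \<B>_eq: "\<B> = ss_behavior m p n A B C D"
    using rep unfolding is_representation_def by auto
  from uy obtain x where x:
    "\<And>t. u t \<in> carrier_vec m" "\<And>t. y t \<in> carrier_vec p" "\<And>t. x t \<in> carrier_vec n"
    "\<And>t. x (Suc t) = A *\<^sub>v x t + B *\<^sub>v u t" "\<And>t. y t = C *\<^sub>v x t + D *\<^sub>v u t"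
    unfolding \<B>_eq by (rule ss_behaviorE) (rule that)
  from uy' obtain x' where x':
    "\<And>t. u' t \<in> carrier_vec m" "\<And>t. y' t \<in> carrier_vec p" "\<And>t. x' t \<in> carrier_vec n"
    "\<And>t. x' (Suc t) = A *\<^sub>v x' t + B *\<^sub>v u' t" "\<And>t. y' t = C *\<^sub>v x' t + D *\<^sub>v u' t"
    unfolding \<B>_eq by (rule ss_behaviorE) (rule that)
  define z where "z = x 0 - x' 0"
  have z: "z \<in> carrier_vec n" unfolding z_def using x(3) x'(3) by simp
  have cancel: "(a + c) - (b + c) = a - b"
    if "a \<in> carrier_vec k" "b \<in> carrier_vec k" "c \<in> carrier_vec k" for a b c :: "real vec" and k
    using that by (intro eq_vecI) auto
  \<comment> \<open>Equal inputs make \<open>B *\<^sub>v u t\<close> cancel, so the state difference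
    evolves by \<open>A\<close> alone up to time \<open>l\<close>.\<close>
  have state: "t \<le> l \<Longrightarrow> x t - x' t = A ^\<^sub>m t *\<^sub>v z" for t
  proof (induction t)
    case 0
    then show ?case using z A by (simp add: z_def)
  next
    case (Suc t)
    have "x (Suc t) - x' (Suc t) = A *\<^sub>v x t - A *\<^sub>v x' t"
      unfolding x(4) x'(4) using Suc.prems
      by (simp add: u cancel[of _ n] mult_mat_vec_carrier[OF A x(3)]
          mult_mat_vec_carrier[OF A x'(3)] mult_mat_vec_carrier[OF B x'(1)])
    also have "\<dots> = A *\<^sub>v (x t - x' t)"
      using mult_minus_distrib_mat_vec[OF A x(3) x'(3)] by simp
    also have "\<dots> = A *\<^sub>v (A ^\<^sub>m t *\<^sub>v z)" using Suc by simp
    also have "\<dots> = A ^\<^sub>m (1 + t) *\<^sub>v z"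
      unfolding pow_mat_add_mult_vec[OF A z] using A by simp
    finally show ?case by simp
  qed
  have readout: "y t - y' t = C *\<^sub>v (A ^\<^sub>m t *\<^sub>v z)" if "t \<le> l" for t
  proof -
    have "y t - y' t = C *\<^sub>v x t - C *\<^sub>v x' t"
      unfolding x(5) x'(5) using that
      by (simp add: u cancel[of _ p] mult_mat_vec_carrier[OF C x(3)]
          mult_mat_vec_carrier[OF C x'(3)] mult_mat_vec_carrier[OF D x'(1)])
    also have "\<dots> = C *\<^sub>v (x t - x' t)"
      using mult_minus_distrib_mat_vec[OF C x(3) x'(3)] by simp
    finally show ?thesis using state[OF that] by simp
  qed
  have "C *\<^sub>v (A ^\<^sub>m i *\<^sub>v z) = 0\<^sub>v p" if "i < l" for i
    using readout[of i] that y[OF that] x'(2)[of i] by simp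
  then have "C *\<^sub>v (A ^\<^sub>m l *\<^sub>v z) = 0\<^sub>v p"
    using obs_lag_unobservable[OF A C z] l lag by simp
  then have zero: "y l - y' l = 0\<^sub>v p" using readout by simp
  have "y l = (y l - y' l) + y' l" using x(2)[of l] x'(2)[of l] by auto
  then show ?thesis unfolding zero using x'(2)[of l] by simp
qed

lemma LTI_outputs_unique:
  assumes \<B>: "\<B> \<in> LTI m p" and T: "lag m p \<B> \<le> T"
    and uy: "(u, y) \<in> \<B>" and uy': "(u', y') \<in> \<B>"
    and u: "\<And>t. t < T' \<Longrightarrow> u t = u' t" and y: "\<And>t. t < T \<Longrightarrow> y t = y' t"
  shows "t < T' \<Longrightarrow> y t = y' t"
proof (induction t rule: less_induct)
  case (less t)
  show ?case
  proof (cases "t < T")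
    case False
    \<comment> \<open>Here \<open>?l \<le> T \<le> t\<close>, so there is a window of length
      \<open>?l\<close> ending just before \<open>t\<close>. The outputs agree on it by induction,
      and shifting its start to time 0 makes the output at \<open>t\<close> the next one.\<close>
    let ?l = "lag m p \<B>"
    have "y (?l + (t - ?l)) = y' (?l + (t - ?l))"
      using False T less u
      by (intro LTI_next_output_unique[OF \<B> order_refl LTI_shift[OF \<B> uy] LTI_shift[OF \<B> uy']]) auto
    then show ?thesis using False T by simp
  qed (rule y)
qed

section \<open>Entries of stacked vectors and Hankel matrices\<close>

lemma block_index_less:
  assumes "(s::nat) < k" "r < q"
  shows "q * s + r < q * k"
proof -
  have "q * s + r < q * Suc s" using assms(2) by simp
  also have "\<dots> \<le> q * k" using assms(1) by (intro mult_le_mono) auto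
  finally show ?thesis .
qed

lemma stack_Cons: "stack (a # w) = a @\<^sub>v stack w"
  by (simp add: stack_def)

lemma dim_stack: "set w \<subseteq> carrier_vec q \<Longrightarrow> dim_vec (stack w) = q * length w"
  by (induction w) (auto simp: stack_def)

lemma stack_index:
  assumes "set w \<subseteq> carrier_vec q" "s < length w" "r < q"
  shows "stack w $ (q * s + r) = w ! s $ r"
  using assms
proof (induction w arbitrary: s)
  case (Cons a w)
  have a: "dim_vec a = q" and dim_w: "dim_vec (stack w) = q * length w"
    using Cons.prems(1) by (auto intro: dim_stack)
  show ?case
  proof (cases s)
    case 0
    then show ?thesis using Cons.prems(3) a by (simp add: stack_Cons)
  next
    case (Suc s')
    have "q * s' + r < q * length w" using Cons.prems Suc by (intro block_index_less) auto
    then have "stack (a # w) $ (q * s + r) =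
        (if q * s + r < dim_vec a then a $ (q * s + r) else stack w $ (q * s + r - dim_vec a))"
      unfolding stack_Cons using dim_w a Suc by (intro index_append_vec(1)) simp
    then have "stack (a # w) $ (q * s + r) = stack w $ (q * s' + r)" using a Suc by simp
    also have "\<dots> = w ! s' $ r" using Cons.prems Suc by (intro Cons.IH) auto
    finally show ?thesis using Suc by simp
  qed
qed simp

lemma hankel_dim [simp]:
  "dim_row (hankel q k w) = q * k" "dim_col (hankel q k w) = length w + 1 - k"
  by (simp_all add: hankel_def)

lemma hankel_index:
  assumes "set w \<subseteq> carrier_vec q" "s < k" "r < q" "j < length w + 1 - k"
  shows "hankel q k w $$ (q * s + r, j) = w ! (j + s) $ r"
proof -
  have "hankel q k w $$ (q * s + r, j) = stack (take k (drop j w)) $ (q * s + r)"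
    using assms block_index_less[of s k r q] by (simp add: hankel_def mat_of_cols_index)
  also have "\<dots> = take k (drop j w) ! s $ r"
    using assms by (intro stack_index) (fastforce dest: in_set_takeD in_set_dropD)+
  finally show ?thesis using assms by simp
qed

lemma row_block_mult_index:
  assumes "a < r" "g \<in> carrier_vec (dim_col M)"
  shows "(row_block i r M *\<^sub>v g) $ a = (\<Sum>c<dim_col M. M $$ (i + a, c) * g $ c)"
  using assms by (auto simp: row_block_def scalar_prod_def atLeast0LessThan intro!: sum.cong)

section \<open>Soundness of the prediction procedure\<close>

text \<open>This holds for every admissible \<open>g\<close>: combining the Hankel columns gives a
  trajectory of \<open>\<B>\<close> that reproduces the last \<open>l\<close> past samples and then
  has input \<open>v\<close>, so the lag bound makes its output at time \<open>l\<close> the next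
  output of the given past.\<close>

lemma predict_sound:
  assumes \<B>: "\<B> \<in> LTI m p" and lag: "lag m p \<B> \<le> l"
    and data: "(ud, yd) \<in> restrict_beh \<B> (length ud)"
    and past: "(ub, yb) \<in> restrict_beh \<B> (length ub)"
    and v: "v \<in> carrier_vec m" and l: "l \<le> length ub"
    and y: "Some y \<in> predict m p ud yd ub yb [v] l"
  shows "(ub @ [v], yb @ [y]) \<in> restrict_beh \<B> (Suc (length ub))"
proof -
  \<comment> \<open>With one future sample the Hankel depth \<open>l + Tf\<close> is
    \<open>Suc l\<close>; time \<open>l\<close> of a window is the predicted instant.\<close>
  let ?k = "Suc l" and ?T = "length ub"
  \<comment> \<open>Numbers of columns from the data and from the past; either is 0 when its
    trajectory has at most \<open>l\<close> samples, as for \<open>?n2\<close> if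
    \<open>?T = l\<close>.\<close>
  let ?n1 = "length ud + 1 - Suc l" and ?n2 = "length ub + 1 - Suc l"
  define M where
    "M = four_block_mat (hankel m ?k ud) (hankel m ?k ub) (hankel p ?k yd) (hankel p ?k yb)"
  from data obtain u1 y1 where d: "ud = map u1 [0..<length ud]" "yd = map y1 [0..<length ud]"
    and B1: "(u1, y1) \<in> \<B>"
    unfolding restrict_beh_def by auto
  from past obtain u2 y2 where b: "ub = map u2 [0..<?T]" "yb = map y2 [0..<?T]"
    and B2: "(u2, y2) \<in> \<B>"
    unfolding restrict_beh_def by auto
  have len: "length yd = length ud" "length yb = length ub"
    using d(2) b(2) by (metis length_map length_upt minus_nat.diff_0)+
  have nth: "\<And>i. i < length ud \<Longrightarrow> ud ! i = u1 i" "\<And>i. i < length ud \<Longrightarrow> yd ! i = y1 i"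
    "\<And>i. i < ?T \<Longrightarrow> ub ! i = u2 i" "\<And>i. i < ?T \<Longrightarrow> yb ! i = y2 i"
    by (subst d b, simp)+
  have carrier: "set ud \<subseteq> carrier_vec m" "set yd \<subseteq> carrier_vec p"
    "set ub \<subseteq> carrier_vec m" "set yb \<subseteq> carrier_vec p"
    using LTI_carrier[OF \<B> B1] LTI_carrier[OF \<B> B2]
    by (subst d b, fastforce)+
  have dim_M: "dim_col M = ?n1 + ?n2" by (simp add: M_def len)

  from y obtain g where g: "g \<in> carrier_vec (dim_col M)"
    and Up: "row_block 0 (m * l) M *\<^sub>v g = stack (drop (?T - l) ub)"
    and Uf: "row_block (m * l) m M *\<^sub>v g = stack [v]"
    and Yp: "row_block (m * l + m) (p * l) M *\<^sub>v g = stack (drop (?T - l) yb)"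
    and y_eq: "y = row_block (m * l + m + p * l) p M *\<^sub>v g"
    unfolding predict_def M_def Let_def by (auto split: if_splits)

  txt \<open>The \<open>j\<close>-th Hankel column is the window \<open>[0, l]\<close> of the trajectory \<open>(U j, Y j)\<close> in \<open>\<B>\<close>.\<close>
  define U where "U j = (if j < ?n1 then (\<lambda>t. u1 (t + j)) else (\<lambda>t. u2 (t + (j - ?n1))))" for j
  define Y where "Y j = (if j < ?n1 then (\<lambda>t. y1 (t + j)) else (\<lambda>t. y2 (t + (j - ?n1))))" for j
  \<comment> \<open>\<open>g\<close> weights whole signals rather than windows, so that the
    combination lies in \<open>\<B>\<close> by linearity; only times 0 to \<open>l\<close> are
    compared with \<open>M\<close>.\<close>
  define U' where "U' t = vec m (\<lambda>i. \<Sum>j<dim_col M. U j t $ i * g $ j)" for t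
  define Y' where "Y' t = vec p (\<lambda>i. \<Sum>j<dim_col M. Y j t $ i * g $ j)" for t
  have "(U j, Y j) \<in> \<B>" for j
    using LTI_shift[OF \<B> B1, of j] LTI_shift[OF \<B> B2, of "j - ?n1"]
    by (cases "j < ?n1") (simp_all add: U_def Y_def)
  then have B': "(U', Y') \<in> \<B>"
    unfolding U'_def Y'_def by (intro LTI_linear_combination[OF \<B>])

  have upper: "M $$ (m * s + r, j) = U j s $ r" if "s < ?k" "r < m" "j < dim_col M" for s r j
  proof -
    have "M $$ (m * s + r, j) = (if j < ?n1 then hankel m ?k ud $$ (m * s + r, j)
        else hankel m ?k ub $$ (m * s + r, j - ?n1))"
      unfolding M_def using block_index_less[OF that(1,2)] that(3)[unfolded dim_M]
      by (subst index_mat_four_block(1)) (simp_all add: len del: mult_Suc_right)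
    also have "\<dots> = U j s $ r"
      using that(1) that(3)[unfolded dim_M] hankel_index[OF carrier(1) that(1,2), of j]
        hankel_index[OF carrier(3) that(1,2), of "j - ?n1"]
        nth(1)[of "j + s"] nth(3)[of "j - ?n1 + s"]
      by (auto simp: U_def add.commute[of s])
    finally show ?thesis .
  qed
  \<comment> \<open>Output rows come after all \<open>m * ?k\<close> input rows;
    \<open>s < l\<close> lies in the past block and \<open>s = l\<close> in the future block, as in
    \<open>upper\<close>.\<close>
  have lower: "M $$ (m * ?k + (p * s + r), j) = Y j s $ r"
    if "s < ?k" "r < p" "j < dim_col M" for s r j
  proof -
    have "M $$ (m * ?k + (p * s + r), j) = (if j < ?n1 then hankel p ?k yd $$ (p * s + r, j)
        else hankel p ?k yb $$ (p * s + r, j - ?n1))"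
      unfolding M_def using block_index_less[OF that(1,2)] that(3)[unfolded dim_M]
      by (subst index_mat_four_block(1)) (simp_all add: len del: mult_Suc_right)
    also have "\<dots> = Y j s $ r"
      using that(1) that(3)[unfolded dim_M] hankel_index[OF carrier(2) that(1,2), of j]
        hankel_index[OF carrier(4) that(1,2), of "j - ?n1"]
        nth(2)[of "j + s"] nth(4)[of "j - ?n1 + s"]
      by (auto simp: Y_def len add.commute[of s])
    finally show ?thesis .
  qed

  \<comment> \<open>The first \<open>l\<close> instants of the window are the last \<open>l\<close>
    instants of the past, hence the offset \<open>?T - l\<close>.\<close>
  have U'_past: "U' s = ub ! (?T - l + s)" if s: "s < l" for s
  proof (rule eq_vecI)
    have "?T - l + s < ?T" using s l by simp
    then have "ub ! (?T - l + s) \<in> carrier_vec m" using carrier(3) nth_mem by blast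
    then show "dim_vec (U' s) = dim_vec (ub ! (?T - l + s))" by (simp add: U'_def)
    fix r assume "r < dim_vec (ub ! (?T - l + s))"
    then have r: "r < m" using \<open>ub ! (?T - l + s) \<in> carrier_vec m\<close> by simp
    have "U' s $ r = (row_block 0 (m * l) M *\<^sub>v g) $ (m * s + r)"
      using s r by (subst row_block_mult_index[OF block_index_less[OF s r] g])
        (auto simp: U'_def upper intro!: sum.cong)
    also have "\<dots> = drop (?T - l) ub ! s $ r"
      unfolding Up using s r l carrier(3) set_drop_subset[of "?T - l" ub]
      by (intro stack_index) auto
    finally show "U' s $ r = ub ! (?T - l + s) $ r" using l by simp
  qed
  have Y'_past: "Y' s = yb ! (?T - l + s)" if s: "s < l" for s
  proof (rule eq_vecI)
    have "?T - l + s < length yb" using s l len by simp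
    then have "yb ! (?T - l + s) \<in> carrier_vec p" using carrier(4) nth_mem by blast
    then show "dim_vec (Y' s) = dim_vec (yb ! (?T - l + s))" by (simp add: Y'_def)
    fix r assume "r < dim_vec (yb ! (?T - l + s))"
    then have r: "r < p" using \<open>yb ! (?T - l + s) \<in> carrier_vec p\<close> by simp
    have row: "m * l + m + (p * s + r) = m * ?k + (p * s + r)" by simp
    have "Y' s $ r = (row_block (m * l + m) (p * l) M *\<^sub>v g) $ (p * s + r)"
      unfolding row_block_mult_index[OF block_index_less[OF s r] g] row
      using s r by (auto simp: Y'_def lower simp del: mult_Suc_right intro!: sum.cong)
    also have "\<dots> = drop (?T - l) yb ! s $ r"
      unfolding Yp using s r l len carrier(4) set_drop_subset[of "?T - l" yb]
      by (intro stack_index) auto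
    finally show "Y' s $ r = yb ! (?T - l + s) $ r" using l len by simp
  qed
  have U'_l: "U' l = v"
  proof (rule eq_vecI)
    show "dim_vec (U' l) = dim_vec v" using v by (simp add: U'_def)
    fix r assume "r < dim_vec v"
    then have r: "r < m" using v by simp
    have "U' l $ r = (row_block (m * l) m M *\<^sub>v g) $ r"
      unfolding row_block_mult_index[OF r g] using r by (auto simp: U'_def upper intro!: sum.cong)
    also have "\<dots> = v $ r" unfolding Uf using r v by (simp add: stack_def)
    finally show "U' l $ r = v $ r" .
  qed
  have Y'_l: "Y' l = y"
  proof (rule eq_vecI)
    show "dim_vec (Y' l) = dim_vec y" by (simp add: Y'_def y_eq row_block_def)
    fix r assume "r < dim_vec y"
    then have r: "r < p" by (simp add: y_eq row_block_def)
    have row: "m * l + m + p * l + r = m * ?k + (p * l + r)" by simp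
    show "Y' l $ r = y $ r"
      unfolding y_eq row_block_mult_index[OF r g] row
      using r by (auto simp: Y'_def lower simp del: mult_Suc_right intro!: sum.cong)
  qed

  txt \<open>Continue the past with input \<open>v\<close>; its last \<open>l + 1\<close> inputs and last \<open>l\<close> past outputs are those of
    \<open>(U', Y')\<close>, so by the lag bound its next output is \<open>Y' l = y\<close>.\<close>
  obtain y3 where B3: "(u2(?T := v), y3) \<in> \<B>" and y3: "\<And>t. t < ?T \<Longrightarrow> y3 t = y2 t"
    using LTI_carrier[OF \<B> B2] v
    by - (rule LTI_replace_future_input[OF \<B> B2, of "u2(?T := v)" ?T], auto)
  have "y3 (l + (?T - l)) = Y' l"
  proof (rule LTI_next_output_unique[OF \<B> lag LTI_shift[OF \<B> B3] B'])
    fix t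
    show "(u2(?T := v)) (t + (?T - l)) = U' t" if "t \<le> l"
      using that l U'_l U'_past[of t] nth(3)[of "?T - l + t"]
      by (cases "t = l") (auto simp: ac_simps)
    show "y3 (t + (?T - l)) = Y' t" if "t < l"
      using that l Y'_past[of t] nth(4)[of "?T - l + t"] y3[of "t + (?T - l)"]
      by (simp add: ac_simps)
  qed
  then have "y3 ?T = y" using l Y'_l by simp
  moreover have "ub = map (u2(?T := v)) [0..<?T]" by (subst b) simp
  moreover have "yb = map y3 [0..<?T]" by (subst b) (simp add: y3)
  ultimately have "ub @ [v] = map (u2(?T := v)) [0..<Suc ?T]" "yb @ [y] = map y3 [0..<Suc ?T]"
    by simp_all
  then show ?thesis unfolding restrict_beh_def using B3 by blast
qed

text \<open>By \<open>predict_sound\<close> each extended pair is again a restriction of a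
  trajectory of \<open>\<B>\<close>, so it can serve as the past of the next one-step
  prediction.\<close>

lemma predict_and_weave_sound:
  assumes \<B>: "\<B> \<in> LTI m p" and lag: "lag m p \<B> \<le> l"
    and data: "(ud, yd) \<in> restrict_beh \<B> (length ud)"
    and past: "(ub, yb) \<in> restrict_beh \<B> (length ub)"
    and uf: "set uf \<subseteq> carrier_vec m" and l: "l \<le> length ub"
    and yf: "Some yf \<in> predict_and_weave m p ud yd ub yb uf l"
  shows "(ub @ uf, yb @ yf) \<in> restrict_beh \<B> (length ub + length uf)"
  using past uf l yf
proof (induction uf arbitrary: ub yb yf)
  case (Cons v uf)
  \<comment> \<open>A null first prediction yields only \<open>None\<close>, so
    \<open>Some yf\<close> comes from a branch with a predicted sample \<open>y\<close>.\<close>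
  from Cons.prems(4) obtain y ys where y: "Some y \<in> predict m p ud yd ub yb [v] l"
    and ys: "Some ys \<in> predict_and_weave m p ud yd (ub @ [v]) (yb @ [y]) uf l"
    and yf: "yf = y # ys"
    by (auto split: option.splits dest!: map_option_eq_Some[THEN iffD1, OF sym])
  have "(ub @ [v], yb @ [y]) \<in> restrict_beh \<B> (Suc (length ub))"
    using Cons.prems(2) by (intro predict_sound[OF \<B> lag data Cons.prems(1) _ Cons.prems(3) y]) simp
  then show ?case using Cons.IH[OF _ _ _ ys] Cons.prems by (simp add: yf)
qed simp

section \<open>Uniqueness of the continuation and informativity\<close>

text \<open>The past covers the lag, so by \<open>LTI_outputs_unique\<close> it fixes, together with
  the inputs, every output before \<open>T\<close>; the two concatenations coincide, and so do their
  tails.\<close>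

lemma restrict_beh_continuation_unique:
  assumes \<B>: "\<B> \<in> LTI m p" and lag: "lag m p \<B> \<le> length ub"
    and len: "length yb = length ub"
    and yf: "(ub @ uf, yb @ yf) \<in> restrict_beh \<B> T"
    and yf': "(ub @ uf, yb @ yf') \<in> restrict_beh \<B> T"
  shows "yf = yf'"
proof -
  from yf obtain u y where uy: "(u, y) \<in> \<B>"
    and e: "ub @ uf = map u [0..<T]" "yb @ yf = map y [0..<T]"
    unfolding restrict_beh_def by auto
  from yf' obtain u' y' where uy': "(u', y') \<in> \<B>"
    and e': "ub @ uf = map u' [0..<T]" "yb @ yf' = map y' [0..<T]"
    unfolding restrict_beh_def by auto
  have T: "length (ub @ uf) = T" unfolding e(1) by simp
  have u: "u t = u' t" if "t < T" for t
    using arg_cong[OF trans[OF e(1)[symmetric] e'(1)], of "\<lambda>w. w ! t"] that by simp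
  have y: "y t = y' t" if "t < length yb" for t
  proof -
    have t: "t < T" using that len T by simp
    have "y t = (yb @ yf) ! t" "y' t = (yb @ yf') ! t" unfolding e e' using t by simp_all
    then show ?thesis using that by (simp add: nth_append)
  qed
  have "y t = y' t" if "t < T" for t
    by (rule LTI_outputs_unique[OF \<B> lag[folded len] uy uy' u y that])
  then have "yb @ yf = yb @ yf'" unfolding e(2) e'(2) by simp
  then show ?thesis by simp
qed

theorem theorem1:
  fixes m p L N T Tini Tf :: nat
    and \<B>s :: behavior
    and ud yd uini yini uf yf :: traj
  assumes "\<B>s \<in> LTI m p"
    and "lag m p \<B>s \<le> L"
    and "state_dim m p \<B>s \<le> N"
    and "(ud, yd) \<in> restrict_beh \<B>s T"
    and "(uini, yini) \<in> restrict_beh \<B>s Tini"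
    and "uf \<in> trajs m Tf"
    and "Tini \<ge> L_max m p L N ud yd uini yini"
    and "Some yf \<in> predict_and_weave m p ud yd uini yini uf (L_max m p L N ud yd uini yini)"
  shows "informative m p L N ud yd uini yini uf \<and>
         is_unique_prediction m p L N ud yd uini yini uf yf"
proof -
  let ?S = "explaining m p L N ud yd \<inter> explaining m p L N uini yini"
  let ?l = "L_max m p L N ud yd uini yini"
  let ?R = "\<lambda>\<B> yf. (uini @ uf, yini @ yf) \<in> restrict_beh \<B> (length uini + length uf)"
  have lens: "length ud = T" "length uini = Tini" "length yini = length uini"
    using assms(4,5) unfolding restrict_beh_def by auto
  \<comment> \<open>The true system makes the set of explaining systems nonempty, which ties every
    common prediction to \<open>yf\<close>.\<close>
  have true: "\<B>s \<in> ?S"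
    using assms(1-5) lens unfolding explaining_def model_class_def by auto
  \<comment> \<open>\<open>?S\<close> may be infinite, but its lags are bounded by \<open>L\<close>,
    so their maximum exists and bounds each of them.\<close>
  have "finite (lag m p ` ?S)"
    by (rule finite_subset[of _ "{..L}"]) (auto simp: explaining_def model_class_def)
  then have lag: "lag m p \<B> \<le> ?l" if "\<B> \<in> ?S" for \<B>
    unfolding L_max_def using that by (intro Max_ge) auto
  have LTI: "\<B> \<in> LTI m p" if "\<B> \<in> ?S" for \<B>
    using that unfolding explaining_def model_class_def by auto
  \<comment> \<open>The returned \<open>yf\<close> is fixed before \<open>\<B>\<close> is chosen, so
    one vector continues the initial trajectory in every explaining system.\<close>
  have sound: "?R \<B> yf" if "\<B> \<in> ?S" for \<B>
    using that assms(6-8) lens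
    by (intro predict_and_weave_sound[OF LTI[OF that] lag[OF that]])
      (auto simp: explaining_def trajs_def)
  have unique: "yf' = yf" if "\<B> \<in> ?S" "?R \<B> yf'" for \<B> yf'
    using lag[OF that(1)] assms(7) lens
    by (intro restrict_beh_continuation_unique[OF LTI[OF that(1)] _ lens(3) that(2) sound[OF that(1)]]) simp
  from sound[OF true] obtain u y where uy: "(u, y) \<in> \<B>s"
    and yf: "yini @ yf = map y [0..<length uini + length uf]"
    unfolding restrict_beh_def by auto
  have "yf = drop (length uini) (map y [0..<length uini + length uf])"
    unfolding yf[symmetric] using lens by simp
  then have yf_traj: "yf \<in> trajs p (length uf)"
    using LTI_carrier(2)[OF assms(1) uy] by (auto simp: trajs_def drop_map)
  \<comment> \<open>A common prediction is in particular a continuation in \<open>\<B>s\<close>,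
    where \<open>yf\<close> is the only one.\<close>
  have common: "common_prediction m p L N ud yd uini yini uf yf' \<longleftrightarrow> yf' = yf" for yf'
    unfolding common_prediction_def using yf_traj sound unique true by blast
  have "informative m p L N ud yd uini yini uf"
    unfolding informative_def using common yf_traj sound unique by blast
  then show ?thesis unfolding is_unique_prediction_def using common by blast
qed

end
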